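(* For a block-generated ultrafilter $\mathcal{U}$ on $\mathrm{FIN}$, the following are equivalent: (1) $\mathcal{U}$ is block-basic; (2) for every sequence $(X_n)_{n<\omega}$ of infinite block sequences with $[X_n]\in\mathcal{U}$ and $X_{n+1}\le^* X_n$ for all $n$, there is an infinite block sequence $X$ with $[X]\in\mathcal{U}$ and $X\le^* X_n$ for all $n$; (3) $\mathcal{U}$ has the 2-dimensional Ramsey property; (4) $\mathcal{U}$ has the Ramsey property; (5) $\mathcal{U}$ has the $\infty$-dimensional Ramsey property.
   Context: $\mathrm{FIN}$ is the set of nonempty finite subsets of $\omega$. A block sequence is a sequence $X=(x_n)$ in $\mathrm{FIN}$ with $\max x_n<\min x_{n+1}$; $[X]$ is the set of all finite unions $x_{n_1}\cup\dots\cup x_{n_k}$ ($n_1<\dots<n_k$). For block sequences, $Y\le X$ iff every member of $Y$ lies in $[X]$; $X/m$ is the tail $(x_n)_{n\ge k}$ with $k$ least such that $\min x_k\ge m$; $Y\le^* X$ iff $Y/m\le X$ for some $m$. An ultrafilter on $\mathrm{FIN}$ is block-generated if it is generated by sets $[X]$, $X$ an infinite block sequence. Infinite block sequences $X_n=(x^n_k)_k$ converge to $X=(x_k)_k$ if for each $l$ there is $m$ with $x^n_k=x_k$ for all $n\ge m$, $k\le l$. A block-generated $\mathcal{U}$ is block-basic if whenever infinite block sequences $X_n$ with $[X_n]\in\mathcal{U}$ converge to an infinite block sequence $X$ with $[X]\in\mathcal{U}$, some subsequence satisfies $\bigcap_k[X_{n_k}]\in\mathcal{U}$. Let $\mathrm{FIN}^{[n]}$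 be the set of block sequences of length $n$, $\mathrm{FIN}^{[\infty]}$ the set of infinite block sequences (with its Polish topology as a subspace of $\mathrm{FIN}^\omega$), and $[X]^{[n]}$, $[X]^{[\infty]}$ the block sequences of length $n$, resp. infinite, all of whose members lie in $[X]$. $\mathcal{U}$ has the 2-dimensional Ramsey property if for every finite coloring of $\mathrm{FIN}^{[2]}$ there is an infinite block sequence $X$ with $[X]\in\mathcal{U}$ and $[X]^{[2]}$ monochromatic; the Ramsey property if this holds for $\mathrm{FIN}^{[n]}$ for every $n$; the $\infty$-dimensional Ramsey property if for every analytic $\mathcal{A}\subseteq\mathrm{FIN}^{[\infty]}$ there is an infinite block sequence $X$ with $[X]\in\mathcal{U}$ and $[X]^{[\infty]}$ either included in or disjoint from $\mathcal{A}$. *)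

theory Defs
  imports "HOL-Analysis.Analysis"
begin

definition FIN :: "nat set set" where
  "FIN = {s. finite s \<and> s \<noteq> {}}"

definition block_seqs :: "(nat \<Rightarrow> nat set) set" where
  "block_seqs = {X. (\<forall>n. X n \<in> FIN) \<and> (\<forall>n. Max (X n) < Min (X (Suc n)))}"

definition fin_block_seqs :: "nat \<Rightarrow> nat set list set" where
  "fin_block_seqs n = {xs. length xs = n \<and> set xs \<subseteq> FIN \<and>
     (\<forall>i. Suc i < n \<longrightarrow> Max (xs ! i) < Min (xs ! Suc i))}"

definition block_span :: "(nat \<Rightarrow> nat set) \<Rightarrow> nat set set" where
  "block_span X = {(\<Union>i\<in>I. X i) | I. finite I \<and> I \<noteq> {}}"

definition fin_subblocks :: "(nat \<Rightarrow> nat set) \<Rightarrow> nat \<Rightarrow> nat set list set" where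
  "fin_subblocks X n = {xs \<in> fin_block_seqs n. set xs \<subseteq> block_span X}"

definition subblocks :: "(nat \<Rightarrow> nat set) \<Rightarrow> (nat \<Rightarrow> nat set) set" where
  "subblocks X = {Y \<in> block_seqs. range Y \<subseteq> block_span X}"

definition block_le :: "(nat \<Rightarrow> nat set) \<Rightarrow> (nat \<Rightarrow> nat set) \<Rightarrow> bool"  (infix "\<preceq>" 50) where
  "Y \<preceq> X \<longleftrightarrow> (\<forall>n. Y n \<in> block_span X)"

definition block_tail :: "(nat \<Rightarrow> nat set) \<Rightarrow> nat \<Rightarrow> (nat \<Rightarrow> nat set)" where
  "block_tail X m = (\<lambda>n. X (n + (LEAST k. m \<le> Min (X k))))"

definition block_almost_le :: "(nat \<Rightarrow> nat set) \<Rightarrow> (nat \<Rightarrow> nat set) \<Rightarrow> bool"  (infix "\<preceq>\<^sup>*" 50) where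
  "Y \<preceq>\<^sup>* X \<longleftrightarrow> (\<exists>m. block_tail Y m \<preceq> X)"

definition block_converges :: "(nat \<Rightarrow> nat \<Rightarrow> nat set) \<Rightarrow> (nat \<Rightarrow> nat set) \<Rightarrow> bool" where
  "block_converges Xs X \<longleftrightarrow> (\<forall>l. \<exists>m. \<forall>n\<ge>m. \<forall>k\<le>l. Xs n k = X k)"

abbreviation filter_mem :: "'a set \<Rightarrow> 'a filter \<Rightarrow> bool"  (infix "\<in>\<^sub>F" 50) where
  "A \<in>\<^sub>F U \<equiv> eventually (\<lambda>x. x \<in> A) U"

text \<open>An ultrafilter on a subset \<open>S\<close> of a type is represented by the filter it generates
  on the whole type; its members contained in \<open>S\<close> are those of the original ultrafilter.\<close>

definition ultrafilter_on :: "'a set \<Rightarrow> 'a filter \<Rightarrow> bool" where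
  "ultrafilter_on S U \<longleftrightarrow> U \<noteq> bot \<and> S \<in>\<^sub>F U \<and> (\<forall>A\<subseteq>S. A \<in>\<^sub>F U \<or> S - A \<in>\<^sub>F U)"

text \<open>``Generated'' means that the sets \<open>block_span X\<close> form a base, as for ordered-union ultrafilters.
  With a mere subbase, principal ultrafilters would qualify, since two sets \<open>block_span X\<close>, \<open>block_span Y\<close>
  can have a singleton as their intersection.\<close>

definition block_generated :: "nat set filter \<Rightarrow> bool" where
  "block_generated U \<longleftrightarrow> (\<exists>B\<subseteq>block_seqs. \<forall>A. A \<in>\<^sub>F U \<longleftrightarrow> (\<exists>X\<in>B. block_span X \<subseteq> A))"

definition block_basic :: "nat set filter \<Rightarrow> bool" where
  "block_basic U \<longleftrightarrow> block_generated U \<and>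
     (\<forall>Xs. \<forall>X\<in>block_seqs.
        (\<forall>n. Xs n \<in> block_seqs \<and> block_span (Xs n) \<in>\<^sub>F U) \<and> block_span X \<in>\<^sub>F U \<and> block_converges Xs X \<longrightarrow>
        (\<exists>r :: nat \<Rightarrow> nat. strict_mono r \<and> (\<Inter>k. block_span (Xs (r k))) \<in>\<^sub>F U))"

definition ramsey_dim :: "nat \<Rightarrow> nat set filter \<Rightarrow> bool" where
  "ramsey_dim n U \<longleftrightarrow>
     (\<forall>c :: nat set list \<Rightarrow> nat. finite (c ` fin_block_seqs n) \<longrightarrow>
        (\<exists>X\<in>block_seqs. block_span X \<in>\<^sub>F U \<and> (\<exists>i. \<forall>xs\<in>fin_subblocks X n. c xs = i)))"

definition ramsey_property :: "nat set filter \<Rightarrow> bool" where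
  "ramsey_property U \<longleftrightarrow> (\<forall>n. ramsey_dim n U)"

definition block_topology :: "(nat \<Rightarrow> nat set) topology" where
  "block_topology = subtopology (product_topology (\<lambda>_. discrete_topology FIN) UNIV) block_seqs"

lemma topspace_block_topology [simp]: "topspace block_topology = block_seqs"
  by (auto simp: block_topology_def block_seqs_def)

text \<open>Analytic sets as the continuous images of the Baire space (and the empty set); the
  topology on \<^typ>\<open>nat \<Rightarrow> nat\<close> is the product of the discrete topologies.\<close>

definition analytic_in :: "'a topology \<Rightarrow> 'a set \<Rightarrow> bool" where
  "analytic_in T A \<longleftrightarrow> A = {} \<or>
     (\<exists>f :: (nat \<Rightarrow> nat) \<Rightarrow> 'a. continuous_map euclidean T f \<and> range f = A)"

definition ramsey_infinite :: "nat set filter \<Rightarrow> bool" where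
  "ramsey_infinite U \<longleftrightarrow>
     (\<forall>A. analytic_in block_topology A \<longrightarrow>
        (\<exists>X\<in>block_seqs. block_span X \<in>\<^sub>F U \<and> (subblocks X \<subseteq> A \<or> subblocks X \<inter> A = {})))"

end

theory Submission
  imports Defs
begin

text \<open>Everything passes through diagonalization: for \<open>W m \<in> U\<close> there is \<open>[X] \<in> U\<close> such that
  \<open>t \<in> W (Max s)\<close> whenever \<open>s, t \<in> [X]\<close> and \<open>Max s < Min t\<close>. Property (2) gives it by a parity
  argument on gaps, property (3) by colouring a pair according to whether \<open>t \<in> W (Max s)\<close>.
  Conversely, if \<open>X\<^sub>n \<longlonglongrightarrow> X\<close>, diagonalizing the intersections of sufficiently many
  \<open>[X\<^sub>n]\<close> yields the subsequence in (1), and splicing an initial segment of one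
  sequence with tails of others gives (1) \<open>\<Longrightarrow>\<close> (2).

  For (5), call a tree \<open>U\<close>-branching if every node has \<open>U\<close>-many immediate successors. For an
  arbitrary ultrafilter and an analytic set \<open>A\<close> there is a \<open>U\<close>-branching tree whose branches all lie
  in \<open>A\<close> or all avoid \<open>A\<close>; diagonalization then finds \<open>[X] \<in> U\<close> all of whose block
  sequences are branches.\<close>

section \<open>Branching along an ultrafilter\<close>

text \<open>A \<open>U\<close>-branching tree with stem \<open>s\<close> is encoded by a total function giving the admissible successors
  of every finite sequence; its values off the tree are irrelevant.\<close>

definition branches :: "('a list \<Rightarrow> 'a set) \<Rightarrow> 'a list \<Rightarrow> (nat \<Rightarrow> 'a) set" where
  "branches S s = {x. map x [0..<length s] = s \<and> (\<forall>n\<ge>length s. x n \<in> S (map x [0..<n]))}"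

definition forces :: "'a filter \<Rightarrow> 'a list \<Rightarrow> (nat \<Rightarrow> 'a) set \<Rightarrow> bool" where
  "forces U s B \<longleftrightarrow> (\<exists>S. (\<forall>u. S u \<in>\<^sub>F U) \<and> branches S s \<subseteq> B)"

text \<open>Where forcing fails, the full tree is the default, so every \<open>S i u\<close> is
  large and can enter an intersection unconditionally.\<close>

lemma forces_witness:
  obtains S where "\<And>i u. S i u \<in>\<^sub>F U" "\<And>i. forces U (p i) (B i) \<Longrightarrow> branches (S i) (p i) \<subseteq> B i"
proof -
  have "\<forall>i. \<exists>S. (\<forall>u. S u \<in>\<^sub>F U) \<and> (forces U (p i) (B i) \<longrightarrow> branches S (p i) \<subseteq> B i)"
  proof
    fix i
    show "\<exists>S. (\<forall>u. S u \<in>\<^sub>F U) \<and> (forces U (p i) (B i) \<longrightarrow> branches S (p i) \<subseteq> B i)"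
    proof (cases "forces U (p i) (B i)")
      case True
      then show ?thesis unfolding forces_def by blast
    next
      case False
      then show ?thesis by (intro exI[of _ "\<lambda>_. UNIV"]) simp
    qed
  qed
  then obtain S where "\<forall>i. (\<forall>u. S i u \<in>\<^sub>F U) \<and> (forces U (p i) (B i) \<longrightarrow> branches (S i) (p i) \<subseteq> B i)"
    by metis
  then show thesis using that by blast
qed

lemma forces_trivial:
  assumes "\<And>x. map x [0..<length s] = s \<Longrightarrow> x \<in> B"
  shows "forces U s B"
  unfolding forces_def branches_def using assms by (intro exI[of _ "\<lambda>_. UNIV"]) auto

text \<open>Trees are glued: the stem passes only to successors that force \<open>B\<close>, after
  which the tree chosen for that successor is followed.\<close>

lemma forces_snoc:
  assumes "\<forall>\<^sub>F x in U. forces U (s @ [x]) B"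
  shows "forces U s B"
proof -
  obtain S where S: "\<And>x u. S x u \<in>\<^sub>F U"
    "\<And>x. forces U (s @ [x]) B \<Longrightarrow> branches (S x) (s @ [x]) \<subseteq> B"
    using forces_witness[where p="\<lambda>x. s @ [x]" and B="\<lambda>_. B"] by blast
  \<comment> \<open>Past the stem, \<open>u ! length s\<close> recovers the chosen successor; for
    other \<open>u\<close> its value is immaterial, as \<open>S\<close> is large everywhere.\<close>
  define T where "T u = (if u = s then {x. forces U (s @ [x]) B} else S (u ! length s) u)" for u
  have "T u \<in>\<^sub>F U" for u
    using S(1) assms by (simp add: T_def)
  moreover have "x \<in> B" if "x \<in> branches T s" for x
  proof -
    from that have xs: "map x [0..<length s] = s"
      and xT: "\<And>n. n \<ge> length s \<Longrightarrow> x n \<in> T (map x [0..<n])"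
      by (auto simp: branches_def)
    have "forces U (s @ [x (length s)]) B"
      using xT[of "length s"] xs by (simp add: T_def)
    moreover have "x \<in> branches (S (x (length s))) (s @ [x (length s)])"
    proof -
      have "x n \<in> S (x (length s)) (map x [0..<n])" if "n \<ge> Suc (length s)" for n
      proof -
        have "map x [0..<n] \<noteq> s" using that by (metis Suc_n_not_le_n diff_zero length_map length_upt)
        then show ?thesis using xT[of n] that by (simp add: T_def)
      qed
      then show ?thesis using xs by (auto simp: branches_def)
    qed
    ultimately show ?thesis using S(2) by blast
  qed
  ultimately show ?thesis unfolding forces_def by blast
qed

text \<open>Fusion: a filter need not be closed under countable intersections, so the
  \<open>k\<close>-th requirement is taken up only at length \<open>Suc (length s + k)\<close>,
  leaving finitely many at each node.\<close>

lemma forces_Inter: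
  fixes C :: "nat \<Rightarrow> (nat \<Rightarrow> 'a) set"
  assumes "forces U s {x. \<forall>n>length s. \<forall>k. forces U (map x [0..<n]) (C k)}"
  shows "forces U s (\<Inter>k. C k)"
proof -
  obtain R where R: "\<And>u. R u \<in>\<^sub>F U"
    "\<And>x. x \<in> branches R s \<Longrightarrow> \<forall>n>length s. \<forall>k. forces U (map x [0..<n]) (C k)"
    using assms unfolding forces_def[of U s] by blast
  obtain S where S: "\<And>i u. S i u \<in>\<^sub>F U"
    "\<And>i. forces U (fst i) (C (snd i)) \<Longrightarrow> branches (S i) (fst i) \<subseteq> C (snd i)"
    using forces_witness[where p=fst and B="\<lambda>i. C (snd i)"] by blast
  \<comment> \<open>Prefix length \<open>j\<close> handles index \<open>j - Suc (length s)\<close>;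
    for \<open>j \<le> length s\<close> the truncated value 0 only adds a harmless
    constraint.\<close>
  define T where "T u = R u \<inter> (\<Inter>j\<in>{..length u}. S (take j u, j - Suc (length s)) u)" for u
  have "T u \<in>\<^sub>F U" for u
    using R(1) S(1) by (auto simp: T_def eventually_conj_iff intro!: eventually_ball_finite)
  moreover have "x \<in> C k" if x: "x \<in> branches T s" for x k
  proof -
    from x have xR: "x \<in> branches R s"
      by (auto simp: branches_def T_def)
    define j where "j = Suc (length s + k)"
    have "forces U (map x [0..<j]) (C k)"
      using R(2)[OF xR, rule_format, of j k] by (simp add: j_def del: upt_Suc)
    then have "branches (S (map x [0..<j], k)) (map x [0..<j]) \<subseteq> C k"
      using S(2)[of "(map x [0..<j], k)"] by simp
    moreover have "x n \<in> S (map x [0..<j], k) (map x [0..<n])" if "n \<ge> j" for n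
    proof -
      have "x n \<in> T (map x [0..<n])" using x that by (auto simp: branches_def j_def)
      then have "x n \<in> S (take j (map x [0..<n]), j - Suc (length s)) (map x [0..<n])"
        using that by (auto simp: T_def)
      then show ?thesis using that by (simp add: take_map j_def)
    qed
    ultimately show ?thesis by (auto simp: branches_def)
  qed
  ultimately show ?thesis unfolding forces_def by blast
qed

text \<open>\<open>track G\<close> greedily builds a second sequence along a first one, which it takes in reversed order:
  it appends an entry as soon as this is compatible with \<open>G\<close>.\<close>

primrec track :: "('a list \<Rightarrow> nat list \<Rightarrow> bool) \<Rightarrow> 'a list \<Rightarrow> nat list" where
  "track G [] = []"
| "track G (x # v) =
     (if \<exists>k. G (rev v @ [x]) (track G v @ [k])
      then track G v @ [SOME k. G (rev v @ [x]) (track G v @ [k])] else track G v)"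

text \<open>If the tracked sequence stalled, the branch would from then on follow the tree that
  \<open>ext\<close> provides for the current pair, so a compatible extension would appear and the
  greedy rule would take it.\<close>

lemma forces_track:
  fixes G :: "'a list \<Rightarrow> nat list \<Rightarrow> bool"
  assumes G0: "G [] []"
    and step: "\<And>s t. G s t \<Longrightarrow> \<forall>\<^sub>F x in U. G (s @ [x]) t"
    and ext: "\<And>s t. G s t \<Longrightarrow> forces U s {x. \<exists>n>length s. \<exists>k. G (map x [0..<n]) (t @ [k])}"
  shows "forces U [] {x. \<exists>y. \<forall>m. \<exists>n\<ge>m. \<exists>l\<ge>m. G (map x [0..<n]) (map y [0..<l])}"
proof -
  define B :: "'a list \<times> nat list \<Rightarrow> (nat \<Rightarrow> 'a) set"
    where "B = (\<lambda>(s, t). {x. \<exists>n>length s. \<exists>k. G (map x [0..<n]) (t @ [k])})"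
  obtain S where S: "\<And>i u. S i u \<in>\<^sub>F U"
    "\<And>i. forces U (fst i) (B i) \<Longrightarrow> branches (S i) (fst i) \<subseteq> B i"
    using forces_witness[where p=fst and B=B] by blast
  define st where "st u = track G (rev u)" for u
  \<comment> \<open>The first set carries \<open>G\<close> to the next node; the rest keep the
    branch in the trees attached to all its prefixes so far.\<close>
  define T where "T u = {x. G u (st u) \<longrightarrow> G (u @ [x]) (st u)} \<inter>
      (\<Inter>j\<in>{..length u}. S (take j u, st (take j u)) u)" for u
  have "T u \<in>\<^sub>F U" for u
    using S(1) step by (cases "G u (st u)") (auto simp: T_def eventually_conj_iff intro!: eventually_ball_finite)
  moreover have "\<exists>y. \<forall>m. \<exists>n\<ge>m. \<exists>l\<ge>m. G (map x [0..<n]) (map y [0..<l])"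
    if "x \<in> branches T []" for x
  proof -
    from that have xT: "\<And>n. x n \<in> T (map x [0..<n])" by (auto simp: branches_def)
    define \<tau> where "\<tau> n = st (map x [0..<n])" for n
    have tau0: "\<tau> 0 = []" by (simp add: \<tau>_def st_def)
    have tauS: "(\<exists>k. \<tau> (Suc n) = \<tau> n @ [k] \<and> G (map x [0..<Suc n]) (\<tau> n @ [k])) \<or>
       (\<tau> (Suc n) = \<tau> n \<and> (\<nexists>k. G (map x [0..<Suc n]) (\<tau> n @ [k])))" for n
    proof (cases "\<exists>k. G (map x [0..<Suc n]) (\<tau> n @ [k])")
      case True
      then have "\<tau> (Suc n) = \<tau> n @ [SOME k. G (map x [0..<Suc n]) (\<tau> n @ [k])]"
        by (simp add: \<tau>_def st_def rev_map)
      with someI_ex[OF True] show ?thesis by blast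
    next
      case False
      then have "\<tau> (Suc n) = \<tau> n" by (simp add: \<tau>_def st_def rev_map)
      with False show ?thesis by blast
    qed
    have G\<tau>: "G (map x [0..<n]) (\<tau> n)" for n
    proof (induction n)
      case 0
      then show ?case by (simp add: tau0 G0)
    next
      case (Suc n)
      then have "G (map x [0..<Suc n]) (\<tau> n)" using xT[of n] by (simp add: T_def \<tau>_def)
      then show ?case using tauS[of n] by metis
    qed
    have len: "length (\<tau> n) \<le> n" for n
    proof (induction n)
      case (Suc n)
      then show ?case using tauS[of n] by auto
    qed (simp add: tau0)
    have mono: "\<exists>w. \<tau> (n + d) = \<tau> n @ w" for n d
    proof (induction d)
      case (Suc d)
      then show ?case using tauS[of "n + d"] by auto
    qed simp
    have grow: "\<exists>n'. length (\<tau> n') > length (\<tau> n)" for n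
    proof (rule ccontr)
      assume "\<nexists>n'. length (\<tau> n') > length (\<tau> n)"
      then have const: "\<tau> (n + d) = \<tau> n" for d using mono[of n d]
        by (metis append_self_conv append.right_neutral length_append less_add_same_cancel1 length_greater_0_conv)
      have "x m \<in> S (map x [0..<n], \<tau> n) (map x [0..<m])" if "m \<ge> n" for m
        using xT[of m] that by (auto simp: T_def \<tau>_def take_map dest!: bspec[of _ _ n])
      then have "x \<in> branches (S (map x [0..<n], \<tau> n)) (map x [0..<n])"
        by (simp add: branches_def)
      moreover have "forces U (map x [0..<n]) (B (map x [0..<n], \<tau> n))"
        using ext[OF G\<tau>[of n]] by (simp add: B_def)
      ultimately have "x \<in> B (map x [0..<n], \<tau> n)" using S(2) by fastforce
      then obtain n' k where n': "n' > n" "G (map x [0..<n']) (\<tau> n @ [k])" by (auto simp: B_def)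
      then obtain d where d: "n' = Suc (n + d)" using less_imp_Suc_add by blast
      have "\<tau> (Suc (n + d)) = \<tau> (n + d)" using const[of d] const[of "Suc d"] by simp
      moreover have "\<exists>k. G (map x [0..<Suc (n + d)]) (\<tau> (n + d) @ [k])"
        using n' unfolding d const by blast
      ultimately show False using tauS[of "n + d"] by auto
    qed
    have unb: "\<exists>n. length (\<tau> n) \<ge> m" for m
    proof (induction m)
      case (Suc m)
      then show ?case using grow by (metis Suc_leI le_less_trans)
    qed simp
    have agree: "\<tau> n ! i = \<tau> n' ! i" if "i < length (\<tau> n)" "i < length (\<tau> n')" for i n n'
      using that mono[of n "n' - n"] mono[of n' "n - n'"]
      by (cases "n \<le> n'") (auto simp: nth_append)
    \<comment> \<open>The \<open>\<tau> n\<close> are coherent and of unbounded length, so they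
      converge to one sequence \<open>y\<close>.\<close>
    define y where "y i = \<tau> (SOME n. i < length (\<tau> n)) ! i" for i
    have y: "map y [0..<length (\<tau> n)] = \<tau> n" for n
    proof (rule nth_equalityI)
      fix i assume "i < length (map y [0..<length (\<tau> n)])"
      then have i: "i < length (\<tau> n)" by simp
      then have "i < length (\<tau> (SOME n. i < length (\<tau> n)))" by (rule someI)
      from agree[OF this i] i show "map y [0..<length (\<tau> n)] ! i = \<tau> n ! i" by (simp add: y_def)
    qed simp
    have "\<exists>n\<ge>m. \<exists>l\<ge>m. G (map x [0..<n]) (map y [0..<l])" for m
    proof -
      obtain n where n: "length (\<tau> n) \<ge> m" using unb by blast
      then have "n \<ge> m" using len[of n] by simp
      with n G\<tau>[of n] y[of n] show ?thesis by metis
    qed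
    then show ?thesis by blast
  qed
  ultimately show ?thesis unfolding forces_def by blast
qed

text \<open>With \<open>A t\<close> the image of the cylinder of \<open>t\<close>, call \<open>(s, t)\<close> good if no tree with stem \<open>s\<close> avoids
  \<open>A t\<close>. If \<open>(s, t)\<close> is good, then on some tree with stem \<open>s\<close> every branch meets a good \<open>(s', t @ [k])\<close>:
  otherwise, some tree has all its nodes \<open>s'\<close> rejecting every \<open>A (t @ [k])\<close>, and by fusion \<open>s\<close> rejects their
  union \<open>A t\<close>. Iterating produces, along each branch \<open>x\<close>, some \<open>y\<close> with \<open>f y = x\<close> by continuity.\<close>

lemma forces_range_or_complement:
  fixes f :: "(nat \<Rightarrow> nat) \<Rightarrow> nat \<Rightarrow> 'a"
  assumes ultra: "\<And>P. eventually P U \<or> (\<forall>\<^sub>F x in U. \<not> P x)"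
    and cont: "\<And>y k. \<exists>n. \<forall>z. (\<forall>i<n. z i = y i) \<longrightarrow> f z k = f y k"
  shows "forces U [] (range f) \<or> forces U [] (- range f)"
proof (rule disjCI)
  assume not_compl: "\<not> forces U [] (- range f)"
  define A where "A t = f ` {y. map y [0..<length t] = t}" for t
  define good where "good s t \<longleftrightarrow> \<not> forces U s (- A t)" for s t
  have good0: "good [] []" using not_compl by (simp add: good_def A_def)
  have step: "\<forall>\<^sub>F x in U. good (s @ [x]) t" if "good s t" for s t
    using that forces_snoc ultra unfolding good_def by blast
  have ext: "forces U s {x. \<exists>n>length s. \<exists>k. good (map x [0..<n]) (t @ [k])}" if g: "good s t" for s t
  proof (rule ccontr)
    let ?O = "{x. \<exists>n>length s. \<exists>k. good (map x [0..<n]) (t @ [k])}"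
    assume nO: "\<not> forces U s ?O"
    \<comment> \<open>Not forcing \<open>?O\<close> passes to \<open>U\<close>-many successors, by
      \<open>forces_snoc\<close> and the ultrafilter dichotomy.\<close>
    define T where "T u = {x. \<not> forces U u ?O \<longrightarrow> \<not> forces U (u @ [x]) ?O}" for u
    have "T u \<in>\<^sub>F U" for u
      using forces_snoc[of U u ?O] ultra unfolding T_def by (cases "forces U u ?O") auto
    moreover have "\<forall>n>length s. \<forall>k. forces U (map x [0..<n]) (- A (t @ [k]))" if x: "x \<in> branches T s" for x
    proof (intro allI impI)
      fix n k assume n: "n > length s"
      have nf: "\<not> forces U (map x [0..<n]) ?O" if "n \<ge> length s" for n
        using that
      proof (induction n rule: dec_induct)
        case base
        then show ?case using nO x by (simp add: branches_def)
      next
        case (step n)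
        then have "x n \<in> T (map x [0..<n])" using x by (simp add: branches_def)
        then show ?case using step by (simp add: T_def)
      qed
      show "forces U (map x [0..<n]) (- A (t @ [k]))"
      proof (rule ccontr)
        assume "\<not> ?thesis"
        then have "good (map x [0..<n]) (t @ [k])" by (simp add: good_def)
        then have "forces U (map x [0..<n]) ?O"
          using n by (intro forces_trivial) (metis (mono_tags, lifting) diff_zero length_map length_upt mem_Collect_eq)
        with nf n show False by simp
      qed
    qed
    ultimately have "forces U s {x. \<forall>n>length s. \<forall>k. forces U (map x [0..<n]) (- A (t @ [k]))}"
      unfolding forces_def[of U s] by blast
    then have "forces U s (\<Inter>k. - A (t @ [k]))" by (rule forces_Inter)
    moreover have "(\<Inter>k. - A (t @ [k])) = - A t" by (auto simp: A_def)
    ultimately show False using g by (simp add: good_def)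
  qed
  have "forces U [] {x. \<exists>y. \<forall>m. \<exists>n\<ge>m. \<exists>l\<ge>m. good (map x [0..<n]) (map y [0..<l])}"
    using good0 step ext by (rule forces_track)
  moreover have "{x. \<exists>y. \<forall>m. \<exists>n\<ge>m. \<exists>l\<ge>m. good (map x [0..<n]) (map y [0..<l])} \<subseteq> range f"
  proof clarify
    fix x y assume xy: "\<forall>m. \<exists>n\<ge>m. \<exists>l\<ge>m. good (map x [0..<n]) (map y [0..<l])"
    have "x k = f y k" for k
    proof -
      obtain N where N: "\<And>z. (\<forall>i<N. z i = y i) \<Longrightarrow> f z k = f y k" using cont by blast
      obtain n l where nl: "n \<ge> max N (Suc k)" "l \<ge> max N (Suc k)" "good (map x [0..<n]) (map y [0..<l])"
        using xy by blast
      \<comment> \<open>Were there no such \<open>z\<close>, the full tree with this stem would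
        avoid \<open>A (map y [0..<l])\<close>, contradicting goodness.\<close>
      have "\<exists>z. map z [0..<n] = map x [0..<n] \<and> z \<in> A (map y [0..<l])"
        using nl(3) forces_trivial[of "map x [0..<n]" "- A (map y [0..<l])" U] by (auto simp: good_def)
      then obtain z where z: "map (f z) [0..<n] = map x [0..<n]" "map z [0..<l] = map y [0..<l]"
        by (auto simp: A_def)
      have "x k = f z k" using z(1) nl(1) by (auto simp: map_eq_conv)
      moreover have "f z k = f y k" using z(2) nl(2) by (intro N) (auto simp: map_eq_conv)
      ultimately show ?thesis by simp
    qed
    then show "x \<in> range f" by auto
  qed
  ultimately show "forces U [] (range f)" unfolding forces_def by blast
qed

section \<open>Analytic sets of block sequences\<close>

lemma open_nat_seq_contains_cylinder:
  fixes V :: "(nat \<Rightarrow> nat) set"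
  assumes "open V" "y \<in> V"
  shows "\<exists>n. \<forall>z. (\<forall>i<n. z i = y i) \<longrightarrow> z \<in> V"
proof -
  have "openin (product_topology (\<lambda>_. euclidean) UNIV) V"
    using assms(1) by (simp add: euclidean_product_topology)
  from product_topology_open_contains_basis[OF this assms(2)]
  obtain X where X: "y \<in> (\<Pi>\<^sub>E i\<in>UNIV. X i)" "finite {i. X i \<noteq> (UNIV :: nat set)}" "(\<Pi>\<^sub>E i\<in>UNIV. X i) \<subseteq> V"
    by auto
  then obtain n where n: "{i. X i \<noteq> UNIV} \<subseteq> {..<n}" using finite_nat_iff_bounded by blast
  have "z \<in> V" if "\<forall>i<n. z i = y i" for z
  proof -
    have "z i \<in> X i" for i
      using X(1) n that by (cases "i < n") (auto simp: PiE_iff)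
    then show ?thesis using X(3) by (auto simp: PiE_iff)
  qed
  then show ?thesis by blast
qed

lemma open_cylinder: "open {z :: nat \<Rightarrow> nat. \<forall>i<n. z i = y i}"
proof -
  have "{z :: nat \<Rightarrow> nat. \<forall>i<n. z i = y i} = (\<Inter>i\<in>{..<n}. (\<lambda>z. z i) -` {y i})" by auto
  moreover have "open ((\<lambda>z :: nat \<Rightarrow> nat. z i) -` {y i})" for i
    by (intro open_vimage continuous_on_product_coordinates open_discrete)
  ultimately show ?thesis by (simp add: open_INT)
qed

text \<open>As \<open>FIN\<close> is discrete, continuity means that each entry is locally constant;
  the tree argument uses this finite-dependence form.\<close>

lemma continuous_map_block_topology_iff:
  fixes f :: "(nat \<Rightarrow> nat) \<Rightarrow> nat \<Rightarrow> nat set"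
  shows "continuous_map euclidean block_topology f \<longleftrightarrow>
    range f \<subseteq> block_seqs \<and> (\<forall>y k. \<exists>n. \<forall>z. (\<forall>i<n. z i = y i) \<longrightarrow> f z k = f y k)"
    (is "?L \<longleftrightarrow> _ \<and> ?R")
proof -
  have L: "?L \<longleftrightarrow> range f \<subseteq> block_seqs \<and> (\<forall>k. continuous_map euclidean (discrete_topology FIN) (\<lambda>y. f y k))"
    unfolding block_topology_def continuous_map_in_subtopology continuous_map_componentwise_UNIV
    by auto
  have "(\<forall>k. continuous_map euclidean (discrete_topology FIN) (\<lambda>y. f y k)) = ?R"
    if sub: "range f \<subseteq> block_seqs"
  proof (intro iffI allI)
    fix y k assume "\<forall>k. continuous_map euclidean (discrete_topology FIN) (\<lambda>y. f y k)"
    moreover have "f y k \<in> FIN" using sub by (auto simp: block_seqs_def)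
    ultimately have "openin euclidean {z \<in> topspace euclidean. f z k \<in> {f y k}}"
      by (intro openin_continuous_map_preimage) auto
    then show "\<exists>n. \<forall>z. (\<forall>i<n. z i = y i) \<longrightarrow> f z k = f y k"
      using open_nat_seq_contains_cylinder[of "{z. f z k = f y k}" y] by simp
  next
    fix k assume R: ?R
    have "open {z. f z k \<in> S}" for S
    proof (rule open_subopen[THEN iffD2], rule ballI)
      fix y assume y: "y \<in> {z. f z k \<in> S}"
      from R obtain n where n: "\<forall>z. (\<forall>i<n. z i = y i) \<longrightarrow> f z k = f y k" by metis
      show "\<exists>T. open T \<and> y \<in> T \<and> T \<subseteq> {z. f z k \<in> S}"
      proof (intro exI[of _ "{z. \<forall>i<n. z i = y i}"] conjI open_cylinder subsetI)
        fix z assume "z \<in> {z. \<forall>i<n. z i = y i}"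
        then have "f z k = f y k" using n[THEN spec, of z] by simp
        then show "z \<in> {z. f z k \<in> S}" using y by simp
      qed simp
    qed
    moreover have "f y k \<in> FIN" for y using sub by (auto simp: block_seqs_def)
    ultimately show "continuous_map euclidean (discrete_topology FIN) (\<lambda>y. f y k)"
      by (simp add: continuous_map_def)
  qed
  then show ?thesis unfolding L by (rule conj_cong[OF refl])
qed

section \<open>Coding block sequences by the Baire space\<close>

text \<open>An entry whose code would break the block order becomes the singleton just past the
  previous block. Every input thus gives a block sequence, while correct codes are decoded
  faithfully.\<close>

primrec block_decode :: "(nat \<Rightarrow> nat) \<Rightarrow> nat \<Rightarrow> nat set" where
  "block_decode x 0 = from_nat_into FIN (x 0)"
| "block_decode x (Suc n) =
     (if Max (block_decode x n) < Min (from_nat_into FIN (x (Suc n)))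
      then from_nat_into FIN (x (Suc n)) else {Suc (Max (block_decode x n))})"

lemma range_from_nat_into_FIN: "range (from_nat_into FIN) = FIN"
proof (rule range_from_nat_into)
  show "FIN \<noteq> {}" by (auto simp: FIN_def)
  have "FIN \<subseteq> Collect finite" by (auto simp: FIN_def)
  then show "countable FIN" using countable_Collect_finite countable_subset by blast
qed

lemma block_decode_block_seqs: "block_decode x \<in> block_seqs"
proof -
  have e: "from_nat_into FIN i \<in> FIN" for i using range_from_nat_into_FIN by blast
  have "block_decode x n \<in> FIN" for n
    using e by (cases n) (auto simp: FIN_def)
  then show ?thesis by (auto simp: block_seqs_def)
qed

lemma block_decode_cong: "(\<And>i. i \<le> k \<Longrightarrow> z i = y i) \<Longrightarrow> block_decode z k = block_decode y k"
  by (induction k) auto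

lemma block_decode_surj:
  assumes "Y \<in> block_seqs"
  obtains x where "block_decode x = Y"
proof -
  have "\<forall>i. \<exists>j. from_nat_into FIN j = Y i"
    using assms range_from_nat_into_FIN by (metis (mono_tags, lifting) block_seqs_def image_iff mem_Collect_eq)
  then obtain x where x: "\<And>i. from_nat_into FIN (x i) = Y i" by metis
  have "block_decode x n = Y n" for n
    using assms by (induction n) (auto simp: x block_seqs_def)
  then show thesis using that by blast
qed

text \<open>Finitely many entries decide membership, so sending all non-members to a fixed member
  \<open>Z\<close> is continuous and yields exactly this set as range.\<close>

lemma analytic_in_block_prefix: "analytic_in block_topology {Y \<in> block_seqs. P (map Y [0..<n])}"
proof (cases "{Y \<in> block_seqs. P (map Y [0..<n])} = {}")
  case False
  then obtain Z where Z: "Z \<in> block_seqs" "P (map Z [0..<n])" by blast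
  define f where "f x = (if P (map (block_decode x) [0..<n]) then block_decode x else Z)" for x
  have "range f \<subseteq> block_seqs" using Z block_decode_block_seqs by (auto simp: f_def)
  moreover have "\<exists>m. \<forall>z. (\<forall>i<m. z i = y i) \<longrightarrow> f z k = f y k" for y k
  proof (intro exI allI impI)
    fix z assume z: "\<forall>i<Suc (n + k). z i = y i"
    then have *: "block_decode z j = block_decode y j" if "j \<le> n + k" for j
      using that by (intro block_decode_cong) auto
    then have "map (block_decode z) [0..<n] = map (block_decode y) [0..<n]" by simp
    then show "f z k = f y k" using *[of k] by (simp add: f_def del: map_eq_conv)
  qed
  moreover have "range f = {Y \<in> block_seqs. P (map Y [0..<n])}"
  proof (intro equalityI subsetI)
    fix Y assume Y: "Y \<in> {Y \<in> block_seqs. P (map Y [0..<n])}"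
    then have "Y \<in> block_seqs" by simp
    then obtain x where "block_decode x = Y" by (rule block_decode_surj)
    with Y have "f x = Y" by (simp add: f_def)
    then show "Y \<in> range f" by blast
  qed (use Z block_decode_block_seqs in \<open>auto simp: f_def\<close>)
  ultimately have "continuous_map euclidean block_topology f" "range f = {Y \<in> block_seqs. P (map Y [0..<n])}"
    by (simp_all only: continuous_map_block_topology_iff simp_thms)
  then show ?thesis unfolding analytic_in_def by blast
qed (simp add: analytic_in_def)

section \<open>Block sequences\<close>

lemma FIN_D: "s \<in> FIN \<Longrightarrow> finite s" "s \<in> FIN \<Longrightarrow> s \<noteq> {}"
  by (auto simp: FIN_def)

lemma FIN_Min_le_Max: "s \<in> FIN \<Longrightarrow> Min s \<le> Max s"
  by (simp add: FIN_def)

lemma block_seqs_FIN: "X \<in> block_seqs \<Longrightarrow> X n \<in> FIN"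
  by (simp add: block_seqs_def)

lemma block_seqs_less:
  assumes "X \<in> block_seqs" "i < j"
  shows "Max (X i) < Min (X j)"
  using assms(2)
proof (induction j rule: less_induct)
  case (less j)
  then obtain k where k: "j = Suc k" by (cases j) auto
  have "Max (X k) < Min (X j)" using assms(1) k by (simp add: block_seqs_def)
  moreover have "Max (X i) \<le> Max (X k)"
    using less k FIN_Min_le_Max[OF block_seqs_FIN[OF assms(1), of k]] by (cases "i = k") force+
  ultimately show ?case by simp
qed

lemma block_seqs_ge_index:
  assumes "X \<in> block_seqs"
  shows "i \<le> Min (X i)"
proof (induction i)
  case (Suc i)
  then show ?case
    using block_seqs_less[OF assms, of i "Suc i"] FIN_Min_le_Max[OF block_seqs_FIN[OF assms, of i]] by simp
qed simp

lemma block_span_UN_I: "finite I \<Longrightarrow> I \<noteq> {} \<Longrightarrow> (\<Union>i\<in>I. X i) \<in> block_span X"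
  by (auto simp: block_span_def)

lemma block_span_member: "X i \<in> block_span X"
  using block_span_UN_I[of "{i}" X] by simp

lemma block_span_E:
  assumes "s \<in> block_span X" "X \<in> block_seqs"
  obtains I where "finite I" "I \<noteq> {}" "s = (\<Union>i\<in>I. X i)" "\<forall>i\<in>I. Min s \<le> Min (X i) \<and> Max (X i) \<le> Max s"
proof -
  from assms(1) obtain I where I: "finite I" "I \<noteq> {}" "s = (\<Union>i\<in>I. X i)"
    by (auto simp: block_span_def)
  have fin: "finite s" using I block_seqs_FIN[OF assms(2)] by (auto simp: FIN_def)
  have sub: "X i \<subseteq> s" if "i \<in> I" for i using I that by auto
  show thesis using that[OF I] sub fin block_seqs_FIN[OF assms(2)]
    by (metis FIN_D(2) Max_mono Min_antimono)
qed

lemma block_span_FIN: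
  assumes "X \<in> block_seqs" "s \<in> block_span X"
  shows "s \<in> FIN"
  using assms(2) block_seqs_FIN[OF assms(1)] by (auto simp: block_span_def FIN_def)

lemma block_span_Un:
  assumes "s \<in> block_span X" "t \<in> block_span X"
  shows "s \<union> t \<in> block_span X"
proof -
  obtain I J where "finite I" "I \<noteq> {}" "s = (\<Union>i\<in>I. X i)" "finite J" "t = (\<Union>i\<in>J. X i)"
    using assms by (auto simp: block_span_def)
  then show ?thesis using block_span_UN_I[of "I \<union> J" X] by (simp add: UN_Un)
qed

lemma block_span_UN_span:
  assumes "finite I" "I \<noteq> {}" "\<And>i. i \<in> I \<Longrightarrow> Y i \<in> block_span X"
  shows "(\<Union>i\<in>I. Y i) \<in> block_span X"
  using assms by (induction I rule: finite_ne_induct) (auto intro: block_span_Un)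

lemma block_le_iff: "Y \<preceq> X \<longleftrightarrow> block_span Y \<subseteq> block_span X"
proof
  assume "Y \<preceq> X"
  then show "block_span Y \<subseteq> block_span X"
    unfolding block_le_def block_span_def[of Y] using block_span_UN_span[of _ Y X] by blast
qed (auto simp: block_le_def block_span_member)

lemma block_span_shift:
  assumes "finite I" "I \<noteq> {}" "\<And>i. i \<in> I \<Longrightarrow> d \<le> i"
  shows "(\<Union>i\<in>I. X i) \<in> block_span (\<lambda>n. X (n + d))"
proof -
  have "(\<Union>i\<in>I. X i) = (\<Union>i\<in>(\<lambda>i. i - d) ` I. X (i + d))" using assms(3) by auto
  then show ?thesis using block_span_UN_I[of "(\<lambda>i. i - d) ` I" "\<lambda>n. X (n + d)"] assms by simp
qed

text \<open>All blocks making up \<open>s\<close> start at \<open>Min s\<close> or later, so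
  \<open>m \<le> Min s\<close> forces their indices to be at least the one where the tail
  begins.\<close>

lemma block_span_tail:
  assumes X: "X \<in> block_seqs"
  shows "block_span (block_tail X m) = {s \<in> block_span X. m \<le> Min s}"
proof -
  define d where "d = (LEAST k. m \<le> Min (X k))"
  have "m \<le> Min (X m)" using block_seqs_ge_index[OF X] .
  then have d: "m \<le> Min (X d)" unfolding d_def by (rule LeastI)
  have tail: "block_tail X m = (\<lambda>n. X (n + d))" by (simp add: block_tail_def d_def)
  show ?thesis
  proof (intro equalityI subsetI)
    fix s assume s: "s \<in> block_span (block_tail X m)"
    then obtain I where I: "finite I" "I \<noteq> {}" "s = (\<Union>i\<in>I. X (i + d))"
      unfolding tail block_span_def by auto
    then have "s \<in> block_span X" using block_span_UN_span[of I "\<lambda>i. X (i + d)" X] block_span_member by blast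
    moreover have "m \<le> a" if "a \<in> X (i + d)" for a i
    proof -
      have "Min (X (i + d)) \<le> a" using that FIN_D[OF block_seqs_FIN[OF X]] by simp
      moreover have "Min (X d) \<le> Min (X (i + d))"
        using block_seqs_less[OF X, of d "i + d"] FIN_Min_le_Max[OF block_seqs_FIN[OF X, of d]]
        by (cases "i = 0") auto
      ultimately show ?thesis using d by simp
    qed
    ultimately show "s \<in> {s \<in> block_span X. m \<le> Min s}"
      using I block_span_FIN[OF X, of s] FIN_D[of s] by auto
  next
    fix s assume s: "s \<in> {s \<in> block_span X. m \<le> Min s}"
    then have "s \<in> block_span X" by simp
    then obtain I where I: "finite I" "I \<noteq> {}" "s = (\<Union>i\<in>I. X i)" "\<forall>i\<in>I. Min s \<le> Min (X i) \<and> Max (X i) \<le> Max s"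
      using X by (rule block_span_E)
    have "d \<le> i" if "i \<in> I" for i
      unfolding d_def using bspec[OF I(4) that] s by (intro Least_le) simp
    then show "s \<in> block_span (block_tail X m)"
      unfolding tail I(3) using I by (intro block_span_shift) auto
  qed
qed

lemma block_almost_le_iff:
  assumes "Y \<in> block_seqs"
  shows "Y \<preceq>\<^sup>* X \<longleftrightarrow> (\<exists>m. \<forall>s\<in>block_span Y. m \<le> Min s \<longrightarrow> s \<in> block_span X)"
  unfolding block_almost_le_def block_le_iff block_span_tail[OF assms] by blast

lemma prefix_fin_block_seqs: "X \<in> block_seqs \<Longrightarrow> map X [0..<n] \<in> fin_block_seqs n"
  by (auto simp: fin_block_seqs_def block_seqs_def)

lemma fin_subblocks_extend:
  assumes Z: "Z \<in> block_seqs" and xs: "xs \<in> fin_subblocks Z n"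
  obtains Y where "Y \<in> subblocks Z" "map Y [0..<n] = xs"
proof -
  \<comment> \<open>Since \<open>i \<le> Min (Z i)\<close>, a shift beyond the last maximum of
    \<open>xs\<close> puts the continuation past \<open>xs\<close>; for \<open>n = 0\<close> nothing
    has to be passed.\<close>
  define d where "d = (if n = 0 then 0 else Suc (Max (xs ! (n - 1))))"
  define Y where "Y j = (if j < n then xs ! j else Z (j + d))" for j
  have len: "length xs = n" and span: "\<And>j. j < n \<Longrightarrow> xs ! j \<in> block_span Z"
    and less: "\<And>i. Suc i < n \<Longrightarrow> Max (xs ! i) < Min (xs ! Suc i)"
    using xs by (auto simp: fin_subblocks_def fin_block_seqs_def)
  have Yspan: "Y j \<in> block_span Z" for j
    using span block_span_member by (auto simp: Y_def)
  have "Max (Y j) < Min (Y (Suc j))" for j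
  proof -
    consider "Suc j < n" | "Suc j = n" | "n \<le> j" by linarith
    then show ?thesis
    proof cases
      case 2
      then show ?thesis using block_seqs_ge_index[OF Z, of "Suc j + d"] by (auto simp: Y_def d_def)
    next
      case 3
      then show ?thesis using block_seqs_less[OF Z] by (simp add: Y_def)
    qed (simp add: Y_def less)
  qed
  then have "Y \<in> block_seqs" using Yspan block_span_FIN[OF Z] by (auto simp: block_seqs_def)
  then have "Y \<in> subblocks Z" using Yspan by (auto simp: subblocks_def)
  moreover have "map Y [0..<n] = xs" using len by (intro nth_equalityI) (auto simp: Y_def)
  ultimately show thesis using that by blast
qed

section \<open>Block-generated ultrafilters\<close>

definition pseudointersection_property :: "nat set filter \<Rightarrow> bool" where
  "pseudointersection_property U \<longleftrightarrow>
     (\<forall>Xs :: nat \<Rightarrow> nat \<Rightarrow> nat set.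
        (\<forall>n. Xs n \<in> block_seqs \<and> block_span (Xs n) \<in>\<^sub>F U \<and> Xs (Suc n) \<preceq>\<^sup>* Xs n) \<longrightarrow>
        (\<exists>X\<in>block_seqs. block_span X \<in>\<^sub>F U \<and> (\<forall>n. X \<preceq>\<^sup>* Xs n)))"

definition diagonalizable :: "nat set filter \<Rightarrow> bool" where
  "diagonalizable U \<longleftrightarrow>
     (\<forall>W. (\<forall>m. W m \<in>\<^sub>F U) \<longrightarrow>
        (\<exists>X\<in>block_seqs. block_span X \<in>\<^sub>F U \<and>
           (\<forall>s\<in>block_span X. \<forall>t\<in>block_span X. Max s < Min t \<longrightarrow> t \<in> W (Max s))))"

lemma diagonalizableE:
  assumes "diagonalizable U" "\<And>m. W m \<in>\<^sub>F U"
  obtains X where "X \<in> block_seqs" "block_span X \<in>\<^sub>F U"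
    "\<forall>s\<in>block_span X. \<forall>t\<in>block_span X. Max s < Min t \<longrightarrow> t \<in> W (Max s)"
  using assms unfolding diagonalizable_def by blast

text \<open>Equivalently, the immediate successor of \<open>i\<close> in \<open>s\<close> lies below
  \<open>f i\<close>; the maximum of \<open>s\<close> never qualifies.\<close>

definition small_gaps :: "(nat \<Rightarrow> nat) \<Rightarrow> nat set \<Rightarrow> nat set" where
  "small_gaps f s = {i \<in> s. \<exists>j\<in>s. i < j \<and> j < f i}"

text \<open>The union keeps the gaps inside \<open>s\<close> and \<open>t\<close> and adds one, from
  \<open>Max s\<close> to \<open>Min t\<close>; so the count exceeds the sum by one exactly when
  that gap is small.\<close>

lemma even_card_small_gaps_Un:
  assumes s: "s \<in> FIN" and t: "t \<in> FIN" and st: "Max s < Min t"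
  shows "even (card (small_gaps f (s \<union> t))) \<longleftrightarrow>
    (even (card (small_gaps f s) + card (small_gaps f t)) \<longleftrightarrow> f (Max s) \<le> Min t)"
proof -
  have fin: "finite (small_gaps f s)" "finite (small_gaps f t)"
    using s t by (auto simp: small_gaps_def FIN_def)
  have le: "i \<le> Max s" if "i \<in> s" for i using s that by (simp add: FIN_def)
  have ge: "Min t \<le> j" if "j \<in> t" for j using t that by (simp add: FIN_def)
  have mem: "Max s \<in> s" "Min t \<in> t" using s t by (auto simp: FIN_def)
  have sub: "small_gaps f s \<subseteq> {..<Max s}" "small_gaps f t \<subseteq> {Min t..}"
    using le ge by (force simp: small_gaps_def)+
  have "{..<Max s} \<inter> {Min t..} = {}" "Max s \<notin> {..<Max s} \<union> {Min t..}" using st by auto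
  then have disj: "small_gaps f s \<inter> small_gaps f t = {}" "Max s \<notin> small_gaps f s \<union> small_gaps f t"
    using sub by blast+
  have eq: "small_gaps f (s \<union> t) =
      small_gaps f s \<union> small_gaps f t \<union> (if Min t < f (Max s) then {Max s} else {})" (is "_ = ?R")
  proof (intro equalityI subsetI)
    fix i assume "i \<in> small_gaps f (s \<union> t)"
    then obtain j where ij: "i \<in> s \<union> t" "j \<in> s \<union> t" "i < j" "j < f i" by (auto simp: small_gaps_def)
    show "i \<in> ?R"
    proof (cases "i \<in> s")
      case True
      then consider "i < Max s" | "i = Max s" using le by fastforce
      then show ?thesis
      proof cases
        case 1
        \<comment> \<open>A witness \<open>j\<close> in \<open>t\<close> can be replaced by
          \<open>Max s\<close>, which is smaller.\<close>
        have "\<exists>j\<in>s. i < j \<and> j < f i"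
          using ij 1 mem(1) ge st by (cases "j \<in> s") force+
        then show ?thesis using True by (simp add: small_gaps_def)
      next
        case 2
        then have "j \<in> t" using ij le by fastforce
        then have "Min t < f (Max s)" using ge ij 2 by fastforce
        then show ?thesis using 2 by simp
      qed
    next
      case False
      then have "i \<in> t" using ij by simp
      then have "j \<notin> s" using le[of j] ge[of i] st ij(3) by linarith
      then show ?thesis using ij \<open>i \<in> t\<close> by (auto simp: small_gaps_def)
    qed
  next
    fix i assume "i \<in> ?R"
    then show "i \<in> small_gaps f (s \<union> t)"
      using mem st by (auto simp: small_gaps_def split: if_splits)
  qed
  have "card (small_gaps f (s \<union> t)) =
      card (small_gaps f s) + card (small_gaps f t) + (if Min t < f (Max s) then 1 else 0)"
    using disj fin unfolding eq by (auto simp: card_Un_disjoint)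
  then show ?thesis by auto
qed

locale block_ultrafilter =
  fixes U :: "nat set filter"
  assumes ultrafilter: "ultrafilter_on FIN U"
    and generated: "block_generated U"
begin

lemma ultra: "eventually P U \<or> (\<forall>\<^sub>F s in U. \<not> P s)"
proof -
  have "\<forall>A\<subseteq>FIN. A \<in>\<^sub>F U \<or> FIN - A \<in>\<^sub>F U" using ultrafilter by (simp add: ultrafilter_on_def)
  then have "FIN \<inter> Collect P \<in>\<^sub>F U \<or> FIN - FIN \<inter> Collect P \<in>\<^sub>F U" by blast
  then show ?thesis
  proof
    assume "FIN \<inter> Collect P \<in>\<^sub>F U"
    then have "eventually P U" by (rule eventually_mono) simp
    then show ?thesis ..
  next
    assume "FIN - FIN \<inter> Collect P \<in>\<^sub>F U"
    then have "\<forall>\<^sub>F s in U. \<not> P s" by (rule eventually_mono) simp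
    then show ?thesis ..
  qed
qed

lemma block_base:
  assumes "A \<in>\<^sub>F U"
  obtains X where "X \<in> block_seqs" "block_span X \<in>\<^sub>F U" "block_span X \<subseteq> A"
proof -
  obtain B where B: "B \<subseteq> block_seqs" "\<And>A. A \<in>\<^sub>F U \<longleftrightarrow> (\<exists>X\<in>B. block_span X \<subseteq> A)"
    using generated unfolding block_generated_def by blast
  then obtain X where "X \<in> B" "block_span X \<subseteq> A" using assms by blast
  moreover have "block_span X \<in>\<^sub>F U" using B(2)[of "block_span X"] \<open>X \<in> B\<close> by blast
  ultimately show thesis using that B(1) by blast
qed

text \<open>A span of sets with minimum below \<open>m\<close> is impossible, since its block of
  index \<open>m\<close> starts at \<open>m\<close> or later.\<close>

lemma large_Min: "{s. m \<le> Min s} \<in>\<^sub>F U"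
proof (rule ccontr)
  assume "\<not> {s. m \<le> Min s} \<in>\<^sub>F U"
  then have "\<forall>\<^sub>F s in U. s \<notin> {s. m \<le> Min s}" using ultra[of "\<lambda>s. s \<in> {s. m \<le> Min s}"] by simp
  then have "{s. \<not> m \<le> Min s} \<in>\<^sub>F U" by simp
  then obtain X where X: "X \<in> block_seqs" "block_span X \<subseteq> {s. \<not> m \<le> Min s}"
    by (rule block_base)
  then show False using block_span_member[of X m] block_seqs_ge_index[OF X(1), of m] by blast
qed

section \<open>Block-basic ultrafilters, pseudointersections and diagonalization\<close>

text \<open>With \<open>Z n\<close> below \<open>Xs 0\<close>, ..., \<open>Xs n\<close>, the hybrids
  \<open>V n\<close> copy \<open>n\<close> blocks of \<open>Z 0\<close>, then follow
  \<open>Z n\<close>, and so converge to \<open>Z 0\<close>. In a large intersection of a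
  subsequence, late sets only involve the part from \<open>Z (r n)\<close>.\<close>

lemma pseudointersection_if_block_basic:
  assumes basic: "block_basic U"
  shows "pseudointersection_property U"
  unfolding pseudointersection_property_def
proof (intro allI impI)
  fix Xs :: "nat \<Rightarrow> nat \<Rightarrow> nat set"
  assume Xs: "\<forall>n. Xs n \<in> block_seqs \<and> block_span (Xs n) \<in>\<^sub>F U \<and> Xs (Suc n) \<preceq>\<^sup>* Xs n"
  have "\<exists>Z. Z \<in> block_seqs \<and> block_span Z \<in>\<^sub>F U \<and> block_span Z \<subseteq> (\<Inter>i\<in>{..n}. block_span (Xs i))" for n
  proof -
    have "(\<Inter>i\<in>{..n}. block_span (Xs i)) \<in>\<^sub>F U"
      using Xs by (simp add: eventually_ball_finite)
    then show ?thesis using block_base by metis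
  qed
  then obtain Z where Z: "\<And>n. Z n \<in> block_seqs" "\<And>n. block_span (Z n) \<in>\<^sub>F U"
    "\<And>n. block_span (Z n) \<subseteq> (\<Inter>i\<in>{..n}. block_span (Xs i))" by metis
  \<comment> \<open>The shift by \<open>d n\<close> puts the tail of \<open>Z n\<close> beyond the
    first \<open>n\<close> blocks of \<open>Z 0\<close>.\<close>
  define d where "d n = Max (Z 0 n)" for n
  define V where "V n k = (if k < n then Z 0 k else Z n (k + d n))" for n k
  have Z0_FIN: "Z 0 i \<in> FIN" for i using block_seqs_FIN[OF Z(1)] .
  have V_bs: "V n \<in> block_seqs" for n
  proof -
    have "Max (V n k) < Min (V n (Suc k))" for k
    proof -
      consider "Suc k < n" | "Suc k = n" | "n \<le> k" by linarith
      then show ?thesis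
      proof cases
        case 1
        then show ?thesis using block_seqs_less[OF Z(1)] by (simp add: V_def)
      next
        case 2
        have "Max (Z 0 k) < Min (Z 0 n)" using block_seqs_less[OF Z(1)] 2 by blast
        also have "\<dots> \<le> d n" using FIN_Min_le_Max[OF Z0_FIN] by (simp add: d_def)
        also have "\<dots> \<le> Min (Z n (n + d n))" using block_seqs_ge_index[OF Z(1)[of n], of "n + d n"] by simp
        finally show ?thesis using 2 by (auto simp: V_def)
      next
        case 3
        then show ?thesis using block_seqs_less[OF Z(1)] by (simp add: V_def)
      qed
    qed
    moreover have "V n k \<in> FIN" for k using block_seqs_FIN[OF Z(1)] by (simp add: V_def)
    ultimately show ?thesis by (simp add: block_seqs_def)
  qed
  have V_U: "block_span (V n) \<in>\<^sub>F U" for n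
  proof -
    \<comment> \<open>Members of the span of \<open>Z n\<close> that start this late use only blocks
      that \<open>V n\<close> retains.\<close>
    have "\<forall>\<^sub>F s in U. s \<in> block_span (Z n) \<and> s \<in> {s. Suc (Max (Z n (n + d n))) \<le> Min s}"
      using Z(2) large_Min by (rule eventually_conj)
    then show ?thesis
    proof (rule eventually_mono)
      fix s assume s: "s \<in> block_span (Z n) \<and> s \<in> {s. Suc (Max (Z n (n + d n))) \<le> Min s}"
      then have "s \<in> block_span (Z n)" by simp
      then obtain I where I: "finite I" "I \<noteq> {}" "s = (\<Union>i\<in>I. Z n i)"
        "\<forall>i\<in>I. Min s \<le> Min (Z n i) \<and> Max (Z n i) \<le> Max s"
        using Z(1) by (rule block_span_E)
      have ge: "n + d n \<le> i" if "i \<in> I" for i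
      proof (rule ccontr)
        assume "\<not> n + d n \<le> i"
        then have "Max (Z n i) < Min (Z n (n + d n))" using block_seqs_less[OF Z(1)] by simp
        then show False
          using bspec[OF I(4) that] s FIN_Min_le_Max[OF block_seqs_FIN[OF Z(1)], of n i]
            FIN_Min_le_Max[OF block_seqs_FIN[OF Z(1)], of n "n + d n"] by simp
      qed
      have "Z n i \<in> block_span (V n)" if "i \<in> I" for i
      proof -
        obtain k where "i = n + d n + k" using le_Suc_ex[OF ge[OF \<open>i \<in> I\<close>]] by blast
        then have "V n (n + k) = Z n i" by (simp add: V_def ac_simps)
        then show ?thesis using block_span_member[of "V n" "n + k"] by simp
      qed
      then show "s \<in> block_span (V n)" unfolding I(3) using I(1,2) by (intro block_span_UN_span)
    qed
  qed
  have conv: "block_converges V (Z 0)"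
    unfolding block_converges_def
  proof
    fix l
    show "\<exists>m. \<forall>n\<ge>m. \<forall>k\<le>l. V n k = Z 0 k" by (rule exI[of _ "Suc l"]) (simp add: V_def)
  qed
  have "(\<forall>n. V n \<in> block_seqs \<and> block_span (V n) \<in>\<^sub>F U) \<and> block_span (Z 0) \<in>\<^sub>F U \<and> block_converges V (Z 0)"
    using V_bs V_U Z(2) conv by blast
  from basic[unfolded block_basic_def, THEN conjunct2, THEN spec, THEN bspec, THEN mp, OF Z(1) this]
  obtain r :: "nat \<Rightarrow> nat" where r: "strict_mono r" "(\<Inter>k. block_span (V (r k))) \<in>\<^sub>F U"
    by blast
  obtain X where X: "X \<in> block_seqs" "block_span X \<in>\<^sub>F U" "block_span X \<subseteq> (\<Inter>k. block_span (V (r k)))"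
    using r(2) by (rule block_base)
  have "X \<preceq>\<^sup>* Xs n" for n
    unfolding block_almost_le_iff[OF X(1)]
  proof (intro exI ballI impI)
    \<comment> \<open>This bound lies beyond every block that \<open>V (r n)\<close> takes from
      \<open>Z 0\<close>.\<close>
    fix s assume s: "s \<in> block_span X" "Suc (d (r n)) \<le> Min s"
    then have "s \<in> block_span (V (r n))" using X(3) by blast
    then obtain I where I: "finite I" "I \<noteq> {}" "s = (\<Union>i\<in>I. V (r n) i)"
      "\<forall>i\<in>I. Min s \<le> Min (V (r n) i) \<and> Max (V (r n) i) \<le> Max s"
      using V_bs by (rule block_span_E)
    have "V (r n) i \<in> block_span (Z (r n))" if "i \<in> I" for i
    proof -
      have "\<not> i < r n"
      proof
        assume "i < r n"
        then have "Min s \<le> Min (Z 0 i)" using bspec[OF I(4) that] by (simp add: V_def)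
        moreover have "Max (Z 0 i) < Min (Z 0 (r n))" using block_seqs_less[OF Z(1)] \<open>i < r n\<close> by blast
        ultimately show False using s(2) FIN_Min_le_Max[OF Z0_FIN[of i]] FIN_Min_le_Max[OF Z0_FIN[of "r n"]]
          by (simp add: d_def)
      qed
      then show ?thesis using block_span_member by (simp add: V_def)
    qed
    then have "s \<in> block_span (Z (r n))" unfolding I(3) using I(1,2) by (intro block_span_UN_span)
    then show "s \<in> block_span (Xs n)" using Z(3) strict_mono_imp_increasing[OF r(1), of n] by blast
  qed
  then show "\<exists>X\<in>block_seqs. block_span X \<in>\<^sub>F U \<and> (\<forall>n. X \<preceq>\<^sup>* Xs n)" using X by blast
qed

text \<open>A pseudointersection \<open>X\<close> of the \<open>W m\<close> diagonalizes them as soon as, for \<open>s\<close> before \<open>t\<close>, the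
  gap between \<open>Max s\<close> and \<open>Min t\<close> is large. Passing to a \<open>U\<close>-large set on which the parity of the
  number of small gaps is constant achieves this: the gap between \<open>s\<close> and \<open>t\<close> then has a fixed kind,
  and it cannot always be small.\<close>

lemma diagonalizable_if_pseudointersection:
  assumes "pseudointersection_property U"
  shows "diagonalizable U"
  unfolding diagonalizable_def
proof (intro allI impI)
  fix W :: "nat \<Rightarrow> nat set set" assume W: "\<forall>m. W m \<in>\<^sub>F U"
  have "\<exists>Xs. \<forall>n. (Xs n \<in> block_seqs \<and> block_span (Xs n) \<in>\<^sub>F U \<and> block_span (Xs n) \<subseteq> W n) \<and>
      Xs (Suc n) \<preceq> Xs n"
  proof (rule dependent_nat_choice)
    show "\<exists>X. X \<in> block_seqs \<and> block_span X \<in>\<^sub>F U \<and> block_span X \<subseteq> W 0"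
      using W block_base by metis
    fix X n assume "X \<in> block_seqs \<and> block_span X \<in>\<^sub>F U \<and> block_span X \<subseteq> W n"
    then have "W (Suc n) \<inter> block_span X \<in>\<^sub>F U" using W by (simp add: eventually_conj_iff)
    then obtain Y where "Y \<in> block_seqs" "block_span Y \<in>\<^sub>F U" "block_span Y \<subseteq> W (Suc n) \<inter> block_span X"
      by (rule block_base)
    then show "\<exists>Y. (Y \<in> block_seqs \<and> block_span Y \<in>\<^sub>F U \<and> block_span Y \<subseteq> W (Suc n)) \<and> Y \<preceq> X"
      by (auto simp: block_le_iff)
  qed
  then obtain Xs where Xs: "\<And>n. Xs n \<in> block_seqs" "\<And>n. block_span (Xs n) \<in>\<^sub>F U"
    "\<And>n. block_span (Xs n) \<subseteq> W n" "\<And>n. Xs (Suc n) \<preceq> Xs n" by blast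
  have "Xs (Suc n) \<preceq>\<^sup>* Xs n" for n
    using Xs(4)[of n] by (auto simp: block_almost_le_iff[OF Xs(1)] block_le_iff)
  then obtain X where X: "X \<in> block_seqs" "block_span X \<in>\<^sub>F U" "\<And>n. X \<preceq>\<^sup>* Xs n"
    using assms Xs unfolding pseudointersection_property_def by metis
  have "\<forall>n. \<exists>m. \<forall>s\<in>block_span X. m \<le> Min s \<longrightarrow> s \<in> block_span (Xs n)"
    using X(3) unfolding block_almost_le_iff[OF X(1)] by blast
  then obtain f where f: "\<And>n s. s \<in> block_span X \<Longrightarrow> f n \<le> Min s \<Longrightarrow> s \<in> block_span (Xs n)"
    by metis
  define E where "E = {s. even (card (small_gaps f s))}"
  have "E \<in>\<^sub>F U \<or> - E \<in>\<^sub>F U" using ultra[of "\<lambda>s. s \<in> E"] by simp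
  then obtain D where D: "D = E \<or> D = - E" "D \<in>\<^sub>F U" by blast
  then have "D \<inter> block_span X \<in>\<^sub>F U" using X(2) by (simp add: eventually_conj_iff)
  then obtain Z where Z: "Z \<in> block_seqs" "block_span Z \<in>\<^sub>F U" "block_span Z \<subseteq> D \<inter> block_span X"
    by (rule block_base)
  have gap: "f (Max s) \<le> Min t \<longleftrightarrow> D = E"
    if st: "s \<in> block_span Z" "t \<in> block_span Z" "Max s < Min t" for s t
  proof -
    have FIN: "s \<in> FIN" "t \<in> FIN" using st block_span_FIN[OF Z(1)] by auto
    have "E \<noteq> - E" by auto
    moreover have "s \<in> D" "t \<in> D" "s \<union> t \<in> D" using Z(3) st block_span_Un by blast+
    \<comment> \<open>The counts for \<open>s\<close> and \<open>t\<close> have equal parity, so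
      their sum is even, and the parity for \<open>s \<union> t\<close> decides the gap.\<close>
    ultimately show ?thesis
      using D(1) even_card_small_gaps_Un[OF FIN st(3), of f] by (auto simp: E_def)
  qed
  have "D = E"
  proof -
    \<comment> \<open>This index makes the gap between \<open>Z 0\<close> and \<open>Z j\<close>
      large, so large is the kind that occurs.\<close>
    define j where "j = Suc (f (Max (Z 0)) + Max (Z 0))"
    have "j \<le> Min (Z j)" using block_seqs_ge_index[OF Z(1)] .
    then show ?thesis using gap[OF block_span_member[of Z 0] block_span_member[of Z j]] by (simp add: j_def)
  qed
  have "t \<in> W (Max s)" if st: "s \<in> block_span Z" "t \<in> block_span Z" "Max s < Min t" for s t
  proof -
    have "f (Max s) \<le> Min t" using gap[OF st] \<open>D = E\<close> by simp
    then show ?thesis using f[of t "Max s"] st(2) Z(3) Xs(3) by blast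
  qed
  then show "\<exists>X\<in>block_seqs. block_span X \<in>\<^sub>F U \<and>
      (\<forall>s\<in>block_span X. \<forall>t\<in>block_span X. Max s < Min t \<longrightarrow> t \<in> W (Max s))"
    using Z by blast
qed

text \<open>With \<open>r k\<close> large enough, \<open>Xs (r k)\<close> shares with
  \<open>X\<close> all blocks that make up \<open>Z 0\<close>, ..., \<open>Z k\<close>;
  diagonalization puts every later \<open>Z i\<close> into its span.\<close>

lemma block_basic_if_diagonalizable:
  assumes diag: "diagonalizable U"
  shows "block_basic U"
  unfolding block_basic_def
proof (intro conjI generated allI ballI impI)
  fix Xs X assume X: "X \<in> block_seqs"
    and "(\<forall>n. Xs n \<in> block_seqs \<and> block_span (Xs n) \<in>\<^sub>F U) \<and> block_span X \<in>\<^sub>F U \<and> block_converges Xs X"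
  then have Xs: "\<And>n. Xs n \<in> block_seqs" "\<And>n. block_span (Xs n) \<in>\<^sub>F U"
    and XU: "block_span X \<in>\<^sub>F U" and conv: "block_converges Xs X" by blast+
  from conv have "\<forall>l. \<exists>m. \<forall>n\<ge>m. \<forall>k\<le>l. Xs n k = X k" by (simp add: block_converges_def)
  then obtain h where h: "\<And>l n k. h l \<le> n \<Longrightarrow> k \<le> l \<Longrightarrow> Xs n k = X k" by metis
  \<comment> \<open>Summing makes \<open>g\<close> strictly increasing, as \<open>r\<close> must be,
    while still dominating \<open>h\<close>.\<close>
  define g where "g l = (\<Sum>j\<le>l. Suc (h j))" for l
  have g_mono: "strict_mono g" by (simp add: strict_mono_Suc_iff g_def)
  have hg: "h l \<le> g l" for l by (cases l) (simp_all add: g_def)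
  have "(\<Inter>n\<in>{..g m}. block_span (Xs n)) \<in>\<^sub>F U" for m
    using Xs(2) by (simp add: eventually_ball_finite)
  then obtain Y where Y: "Y \<in> block_seqs" "block_span Y \<in>\<^sub>F U"
    "\<forall>s\<in>block_span Y. \<forall>t\<in>block_span Y. Max s < Min t \<longrightarrow> t \<in> (\<Inter>n\<in>{..g (Max s)}. block_span (Xs n))"
    by (rule diagonalizableE[OF diag])
  have "block_span Y \<inter> block_span X \<in>\<^sub>F U" using Y(2) XU by (simp add: eventually_conj_iff)
  then obtain Z where Z: "Z \<in> block_seqs" "block_span Z \<in>\<^sub>F U" "block_span Z \<subseteq> block_span Y \<inter> block_span X"
    by (rule block_base)
  define r where "r k = g (Max (Z k))" for k
  have Max_mono: "Max (Z i) < Max (Z k)" if "i < k" for i k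
    using block_seqs_less[OF Z(1) that] FIN_Min_le_Max[OF block_seqs_FIN[OF Z(1), of k]] by simp
  have "strict_mono r" using Max_mono g_mono by (simp add: r_def strict_mono_def)
  moreover have "Z i \<in> block_span (Xs (r k))" for i k
  proof (cases "i \<le> k")
    case True
    have "Z i \<in> block_span X" using Z(3) block_span_member by blast
    then obtain J where J: "finite J" "J \<noteq> {}" "Z i = (\<Union>j\<in>J. X j)"
      "\<forall>j\<in>J. Min (Z i) \<le> Min (X j) \<and> Max (X j) \<le> Max (Z i)"
      using X by (rule block_span_E)
    have "X j = Xs (r k) j" if "j \<in> J" for j
    proof -
      have "j \<le> Max (X j)" using block_seqs_ge_index[OF X, of j] FIN_Min_le_Max[OF block_seqs_FIN[OF X, of j]] by simp
      also have "\<dots> \<le> Max (Z i)" using J(4) that by blast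
      also have "\<dots> \<le> Max (Z k)" using True Max_mono[of i k] by (cases "i = k") auto
      finally show ?thesis using h[OF hg] by (simp add: r_def)
    qed
    then have "Z i = (\<Union>j\<in>J. Xs (r k) j)" using J(3) by simp
    then show ?thesis using block_span_UN_I[OF J(1,2)] by simp
  next
    case False
    then have "Max (Z k) < Min (Z i)" using block_seqs_less[OF Z(1)] by simp
    moreover have "Z k \<in> block_span Y" "Z i \<in> block_span Y" using Z(3) block_span_member by blast+
    ultimately have "Z i \<in> (\<Inter>n\<in>{..g (Max (Z k))}. block_span (Xs n))" using Y(3) by blast
    then show ?thesis by (simp add: r_def)
  qed
  then have "block_span Z \<subseteq> block_span (Xs (r k))" for k
    by (simp add: block_le_iff[symmetric] block_le_def)
  then have "(\<Inter>k. block_span (Xs (r k))) \<in>\<^sub>F U"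
    by (intro eventually_mono[OF Z(2)]) blast
  ultimately show "\<exists>r :: nat \<Rightarrow> nat. strict_mono r \<and> (\<Inter>k. block_span (Xs (r k))) \<in>\<^sub>F U" by blast
qed

section \<open>Ramsey properties and diagonalization\<close>

text \<open>The blocks before a given one, if the last has maximum \<open>m\<close>, form a list of
  subsets of \<open>{..m}\<close> of length at most \<open>Suc m\<close>. Only finitely many nodes
  arise, so diagonalizing the intersections of their successor sets suffices.\<close>

lemma subblocks_branches:
  assumes diag: "diagonalizable U" and S: "\<And>u. S u \<in>\<^sub>F U"
  obtains X where "X \<in> block_seqs" "block_span X \<in>\<^sub>F U" "subblocks X \<subseteq> branches S []"
proof -
  define L where "L m = {u :: nat set list. set u \<subseteq> Pow {..m} \<and> length u \<le> Suc m}" for m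
  have "finite (L m)" for m unfolding L_def by (rule finite_lists_length_le) simp
  then have "(\<Inter>u\<in>L m. S u) \<in>\<^sub>F U" for m using S by (simp add: eventually_ball_finite)
  then obtain Y where Y: "Y \<in> block_seqs" "block_span Y \<in>\<^sub>F U"
    "\<forall>s\<in>block_span Y. \<forall>t\<in>block_span Y. Max s < Min t \<longrightarrow> t \<in> (\<Inter>u\<in>L (Max s). S u)"
    by (rule diagonalizableE[OF diag])
  \<comment> \<open>The root has no preceding block, so diagonalization does not constrain its
    successors.\<close>
  have "block_span Y \<inter> S [] \<in>\<^sub>F U" using Y(2) S by (simp add: eventually_conj_iff)
  then obtain X where X: "X \<in> block_seqs" "block_span X \<in>\<^sub>F U" "block_span X \<subseteq> block_span Y \<inter> S []"
    by (rule block_base)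
  have "V n \<in> S (map V [0..<n])" if V: "V \<in> subblocks X" for V n
  proof (cases n)
    case 0
    then show ?thesis using V X(3) by (auto simp: subblocks_def)
  next
    case (Suc m)
    have Vb: "V \<in> block_seqs" and Vs: "\<And>i. V i \<in> block_span Y"
      using V X(3) by (auto simp: subblocks_def)
    have Max_le: "Max (V i) \<le> Max (V m)" if "i \<le> m" for i
      using block_seqs_less[OF Vb, of i m] FIN_Min_le_Max[OF block_seqs_FIN[OF Vb, of m]] that
      by (cases "i = m") auto
    have sub: "V i \<subseteq> {..Max (V m)}" if "i < n" for i
    proof
      fix a assume "a \<in> V i"
      then have "a \<le> Max (V i)" using FIN_D[OF block_seqs_FIN[OF Vb, of i]] by simp
      then show "a \<in> {..Max (V m)}" using Max_le[of i] that Suc by simp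
    qed
    have "set (map V [0..<n]) \<subseteq> Pow {..Max (V m)}"
      unfolding set_map by (intro image_subsetI PowI sub) simp
    moreover have "m \<le> Max (V m)"
      using block_seqs_ge_index[OF Vb, of m] FIN_Min_le_Max[OF block_seqs_FIN[OF Vb, of m]] by simp
    ultimately have "map V [0..<n] \<in> L (Max (V m))" using Suc by (simp add: L_def)
    moreover have "Max (V m) < Min (V n)" using block_seqs_less[OF Vb] Suc by simp
    ultimately show ?thesis using Y(3) Vs by blast
  qed
  then have "subblocks X \<subseteq> branches S []" by (auto simp: branches_def)
  then show thesis using that X by blast
qed

lemma ramsey_infinite_if_diagonalizable:
  assumes diag: "diagonalizable U"
  shows "ramsey_infinite U"
  unfolding ramsey_infinite_def
proof (intro allI impI)
  fix A assume A: "analytic_in block_topology A"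
  have "forces U [] A \<or> forces U [] (- A)"
  proof (cases "A = {}")
    case True
    then show ?thesis using forces_trivial[of "[]" "- A" U] by simp
  next
    case False
    then obtain f :: "(nat \<Rightarrow> nat) \<Rightarrow> nat \<Rightarrow> nat set"
      where f: "continuous_map euclidean block_topology f" "range f = A"
      using A unfolding analytic_in_def by blast
    then have cont: "\<And>y k. \<exists>n. \<forall>z. (\<forall>i<n. z i = y i) \<longrightarrow> f z k = f y k"
      unfolding continuous_map_block_topology_iff by blast
    show ?thesis using forces_range_or_complement[where f = f, OF ultra cont] by (simp add: f(2))
  qed
  then obtain S B where S: "\<And>u. S u \<in>\<^sub>F U" "branches S [] \<subseteq> B" "B = A \<or> B = - A"
    unfolding forces_def by blast
  obtain X where "X \<in> block_seqs" "block_span X \<in>\<^sub>F U" "subblocks X \<subseteq> branches S []"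
    using diag S(1) by (rule subblocks_branches)
  then show "\<exists>X\<in>block_seqs. block_span X \<in>\<^sub>F U \<and> (subblocks X \<subseteq> A \<or> subblocks X \<inter> A = {})"
    using S(2,3) by blast
qed

text \<open>Colouring a sequence by its first \<open>n\<close> entries makes every colour class
  analytic; finitely many homogeneous spans are intersected.\<close>

lemma ramsey_property_if_ramsey_infinite:
  assumes ramsey: "ramsey_infinite U"
  shows "ramsey_property U"
  unfolding ramsey_property_def ramsey_dim_def
proof (intro allI impI)
  fix n and c :: "nat set list \<Rightarrow> nat" assume fin: "finite (c ` fin_block_seqs n)"
  define A where "A i = {Y \<in> block_seqs. c (map Y [0..<n]) = i}" for i
  have "analytic_in block_topology (A i)" for i
    unfolding A_def by (rule analytic_in_block_prefix)
  then have "\<forall>i. \<exists>X. X \<in> block_seqs \<and> block_span X \<in>\<^sub>F U \<and> (subblocks X \<subseteq> A i \<or> subblocks X \<inter> A i = {})"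
    using ramsey unfolding ramsey_infinite_def by blast
  then obtain X where X: "\<And>i. X i \<in> block_seqs" "\<And>i. block_span (X i) \<in>\<^sub>F U"
    "\<And>i. subblocks (X i) \<subseteq> A i \<or> subblocks (X i) \<inter> A i = {}" by metis
  have "(\<Inter>i\<in>c ` fin_block_seqs n. block_span (X i)) \<in>\<^sub>F U"
    using X(2) eventually_ball_finite[OF fin, of "\<lambda>s i. s \<in> block_span (X i)" U] by simp
  then obtain Z where Z: "Z \<in> block_seqs" "block_span Z \<in>\<^sub>F U"
    "block_span Z \<subseteq> (\<Inter>i\<in>c ` fin_block_seqs n. block_span (X i))"
    by (rule block_base)
  \<comment> \<open>This is the colour of \<open>Z\<close> itself, so of the two alternatives for
    \<open>X i\<close> only inclusion remains.\<close>
  define i where "i = c (map Z [0..<n])"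
  have "block_span Z \<subseteq> block_span (X i)" using Z(3) prefix_fin_block_seqs[OF Z(1)] by (auto simp: i_def)
  then have sub: "subblocks Z \<subseteq> subblocks (X i)" by (auto simp: subblocks_def)
  have "Z \<in> subblocks Z" using Z(1) block_span_member by (auto simp: subblocks_def)
  moreover have "Z \<in> A i" using Z(1) by (simp add: A_def i_def)
  ultimately have "subblocks Z \<subseteq> A i" using sub X(3)[of i] by blast
  then have "c xs = i" if "xs \<in> fin_subblocks Z n" for xs
    using fin_subblocks_extend[OF Z(1) that] by (auto simp: A_def)
  then show "\<exists>X\<in>block_seqs. block_span X \<in>\<^sub>F U \<and> (\<exists>i. \<forall>xs\<in>fin_subblocks X n. c xs = i)"
    using Z by blast
qed

lemma diagonalizable_if_ramsey_dim_2:
  assumes ramsey: "ramsey_dim 2 U"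
  shows "diagonalizable U"
  unfolding diagonalizable_def
proof (intro allI impI)
  fix W :: "nat \<Rightarrow> nat set set" assume W: "\<forall>m. W m \<in>\<^sub>F U"
  define c :: "nat set list \<Rightarrow> nat" where "c xs = of_bool (xs ! 1 \<in> W (Max (xs ! 0)))" for xs
  have "finite (c ` fin_block_seqs 2)"
    by (rule finite_subset[of _ "{0, 1}"]) (auto simp: c_def)
  then obtain X i where X: "X \<in> block_seqs" "block_span X \<in>\<^sub>F U" "\<forall>xs\<in>fin_subblocks X 2. c xs = i"
    using ramsey unfolding ramsey_dim_def by blast
  have hom: "of_bool (t \<in> W (Max s)) = i"
    if st: "s \<in> block_span X" "t \<in> block_span X" "Max s < Min t" for s t
  proof -
    have "[s, t] \<in> fin_subblocks X 2"
      using st block_span_FIN[OF X(1)] by (auto simp: fin_subblocks_def fin_block_seqs_def)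
    then show ?thesis using X(3) by (fastforce simp: c_def)
  qed
  \<comment> \<open>Colour 0 is excluded by a set beyond \<open>X 0\<close> that the span shares
    with the large set \<open>W (Max (X 0))\<close>.\<close>
  have "block_span X \<inter> (W (Max (X 0)) \<inter> {s. Suc (Max (X 0)) \<le> Min s}) \<in>\<^sub>F U"
    using X(2) W large_Min[of "Suc (Max (X 0))"] by (simp add: eventually_conj_iff)
  then obtain Z where "Z \<in> block_seqs"
    "block_span Z \<subseteq> block_span X \<inter> (W (Max (X 0)) \<inter> {s. Suc (Max (X 0)) \<le> Min s})"
    by (rule block_base)
  then have "Z 0 \<in> block_span X" "Z 0 \<in> W (Max (X 0))" "Max (X 0) < Min (Z 0)"
    using block_span_member[of Z 0] by auto
  then have "i = 1" using hom[OF block_span_member[of X 0], of "Z 0"] by simp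
  then have "t \<in> W (Max s)" if "s \<in> block_span X" "t \<in> block_span X" "Max s < Min t" for s t
    using hom[OF that] by (cases "t \<in> W (Max s)") auto
  then show "\<exists>X\<in>block_seqs. block_span X \<in>\<^sub>F U \<and>
      (\<forall>s\<in>block_span X. \<forall>t\<in>block_span X. Max s < Min t \<longrightarrow> t \<in> W (Max s))"
    using X by blast
qed

end

theorem theorem68:
  fixes U :: "nat set filter"
  assumes "ultrafilter_on FIN U"
    and "block_generated U"
  shows "(block_basic U \<longleftrightarrow>
            (\<forall>Xs :: nat \<Rightarrow> nat \<Rightarrow> nat set.
               (\<forall>n. Xs n \<in> block_seqs \<and> block_span (Xs n) \<in>\<^sub>F U \<and> Xs (Suc n) \<preceq>\<^sup>* Xs n) \<longrightarrow>
               (\<exists>X\<in>block_seqs. block_span X \<in>\<^sub>F U \<and> (\<forall>n. X \<preceq>\<^sup>* Xs n)))) \<and>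
         (block_basic U \<longleftrightarrow> ramsey_dim 2 U) \<and>
         (block_basic U \<longleftrightarrow> ramsey_property U) \<and>
         (block_basic U \<longleftrightarrow> ramsey_infinite U)"
proof -
  interpret block_ultrafilter U using assms by unfold_locales
  \<comment> \<open>Diagonalization forms one cycle with the first two conditions and another
    through infinite dimension, all finite dimensions and dimension 2.\<close>
  have "block_basic U \<longleftrightarrow> pseudointersection_property U" "block_basic U \<longleftrightarrow> diagonalizable U"
    using pseudointersection_if_block_basic diagonalizable_if_pseudointersection
      block_basic_if_diagonalizable by blast+
  moreover have "ramsey_property U \<Longrightarrow> ramsey_dim 2 U" by (simp add: ramsey_property_def)
  ultimately show ?thesis
    unfolding pseudointersection_property_def[symmetric]
    using ramsey_infinite_if_diagonalizable ramsey_property_if_ramsey_infinite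
      diagonalizable_if_ramsey_dim_2 by blast
qed

end
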